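(* Assume the Continuum Hypothesis. Then $2^\omega$ does not have the Grinzing property.
   Context: A subset $W$ of $2^\omega$ has the Grinzing property if $W$ is uncountable and for every uncountable $Y\subseteq W$ there exist uncountable subsets $Y_\alpha$ of $Y$, for $\alpha\in\omega_1$, such that $\mathrm{cl}(Y_\alpha)\cap\mathrm{cl}(Y_\beta)=\varnothing$ whenever $\alpha\neq\beta$, where the closure is taken in $2^\omega$. *)

theory Defs
  imports "HOL-Analysis.Analysis"
begin

unbundle cardinal_syntax

text \<open>The first uncountable ordinal, as the carrier of the canonical well-order of
  cardinality aleph-one.\<close>
definition omega1 :: "nat set set" where
  "omega1 = Field (cardSuc natLeq)"

definition Continuum_Hypothesis :: bool where
  "Continuum_Hypothesis \<longleftrightarrow> ctwo ^c natLeq =o cardSuc natLeq"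

text \<open>The Cantor space is the type \<^typ>\<open>nat \<Rightarrow> bool\<close>: its \<^class>\<open>topological_space\<close> instance is the
  product topology, with the discrete topology on \<^typ>\<open>bool\<close>.\<close>
definition Grinzing :: "(nat \<Rightarrow> bool) set \<Rightarrow> bool" where
  "Grinzing W \<longleftrightarrow>
     uncountable W \<and>
     (\<forall>Y. Y \<subseteq> W \<and> uncountable Y \<longrightarrow>
        (\<exists>Z :: nat set \<Rightarrow> (nat \<Rightarrow> bool) set.
           (\<forall>\<alpha>\<in>omega1. Z \<alpha> \<subseteq> Y \<and> uncountable (Z \<alpha>)) \<and>
           (\<forall>\<alpha>\<in>omega1. \<forall>\<beta>\<in>omega1. \<alpha> \<noteq> \<beta> \<longrightarrow> closure (Z \<alpha>) \<inter> closure (Z \<beta>) = {})))"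

end

theory Submission
  imports Defs "HOL-Library.Countable_Set_Type"
begin

text \<open>Under the Continuum Hypothesis there is a Luzin set \<open>Y\<close>: an uncountable set meeting
  every closed set with empty interior in a countable set. It is obtained from the Baire category
  theorem, since the closed nowhere dense sets can be well-ordered with countable initial segments.
  Every uncountable subset of \<open>Y\<close> has a closure with nonempty interior, and a second countable space
  has only countably many pairwise disjoint sets with nonempty interior.\<close>

lemma uncountable_omega1: "uncountable omega1"
proof
  assume "countable omega1"
  then have "|omega1| \<le>o natLeq"
    by (simp add: countable_card_le_natLeq)
  moreover have "|omega1| =o cardSuc natLeq"
    unfolding omega1_def by (rule card_of_Field_ordIso[OF cardSuc_Card_order[OF natLeq_Card_order]])
  moreover have "natLeq <o cardSuc natLeq"
    by (rule cardSuc_greater[OF natLeq_Card_order])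
  ultimately show False
    by (meson not_ordLess_ordLeq ordIso_iff_ordLeq ordLeq_transitive)
qed

text \<open>The cardinal order \<open>|A|\<close> itself serves as \<open>r\<close>: its proper
  initial segments have cardinality below \<open>|A|\<close>, hence below the successor of
  aleph-zero, so they are countable. Adding the endpoint keeps them countable.\<close>

lemma Continuum_Hypothesis_countable_initial_segments:
  assumes "Continuum_Hypothesis" and A: "|A| \<le>o |UNIV :: nat set set|"
  obtains r where "refl_on A r" "total_on A r" "\<And>a. a \<in> A \<Longrightarrow> countable {b. (b, a) \<in> r}"
proof
  have "|UNIV :: nat set set| =o ctwo ^c natLeq"
    using card_of_Pow_Func[of "UNIV :: nat set"]
    by (simp add: cexp_def ctwo_def Field_card_of Field_natLeq)
  with assms have "|A| \<le>o cardSuc natLeq"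
    unfolding Continuum_Hypothesis_def by (meson ordIso_transitive ordLeq_ordIso_trans)
  let ?r = "|A|"
  show "refl_on A ?r" "total_on A ?r"
    using card_of_Well_order[of A]
    by (auto simp: order_on_defs Field_card_of)
  fix a assume "a \<in> A"
  have "|underS ?r a| <o ?r"
    using card_of_underS[OF card_of_Card_order] \<open>a \<in> A\<close> by (simp add: Field_card_of)
  then have "|underS ?r a| <o cardSuc natLeq"
    using \<open>|A| \<le>o cardSuc natLeq\<close> by (rule ordLess_ordLeq_trans)
  then have "countable (underS ?r a)"
    by (simp add: countable_card_le_natLeq cardSuc_ordLeq_ordLess natLeq_Card_order card_of_Card_order)
  moreover have "{b. (b, a) \<in> ?r} \<subseteq> insert a (underS ?r a)"
    by (auto simp: underS_def)
  ultimately show "countable {b. (b, a) \<in> ?r}"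
    by (meson countable_insert countable_subset)
qed

text \<open>The complement of a closed set is the union of the members of a countable basis that it
  contains, so the set of their indices determines the closed set.\<close>

lemma card_of_closed_sets_ordLeq:
  "|{F :: 'a::second_countable_topology set. closed F}| \<le>o |UNIV :: nat set set|"
proof -
  obtain \<B> :: "'a set set" where \<B>: "countable \<B>" "topological_basis \<B>"
    using ex_countable_basis by blast
  define h where "h F = to_nat_on \<B> ` {B \<in> \<B>. B \<subseteq> - F}" for F
  have "inj_on h {F. closed F}"
  proof (rule inj_onI)
    fix F G assume FG: "F \<in> {F. closed F}" "G \<in> {F. closed F}" "h F = h G"
    have "{B \<in> \<B>. B \<subseteq> - F} = {B \<in> \<B>. B \<subseteq> - G}"
      using FG(3) unfolding h_def
      by (rule inj_on_image_eq_iff[OF inj_on_to_nat_on[OF \<B>(1)], THEN iffD1, rotated 2]) auto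
    moreover have "- H = \<Union>{B \<in> \<B>. B \<subseteq> - H}" if "H \<in> {F. closed F}" for H
    proof -
      have "open (- H)"
        using that by auto
      then obtain \<U> where "\<U> \<subseteq> \<B>" "\<Union>\<U> = - H"
        using \<B>(2) unfolding topological_basis_def by metis
      then show ?thesis by blast
    qed
    ultimately have "- F = - G"
      using FG(1,2) by metis
    then show "F = G" by simp
  qed
  then show ?thesis
    using card_of_ordLeq[of "{F :: 'a set. closed F}" "UNIV :: nat set set"] by blast
qed

text \<open>Local compactness and the Hausdorff property give the Baire category theorem; absence of
  isolated points makes singletons nowhere dense. One point is then picked for each closed nowhere
  dense set, outside that set and all earlier ones.\<close>

lemma Luzin_set_exists:
  assumes CH: "Continuum_Hypothesis"
    and lc: "locally_compact_space (euclidean :: 'a::second_countable_topology topology)"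
    and Hausdorff: "Hausdorff_space (euclidean :: 'a::second_countable_topology topology)"
    and perf: "\<And>x :: 'a::second_countable_topology. \<not> open {x}"
  obtains Y :: "'a::second_countable_topology set" where "uncountable Y"
    "\<And>F. closed F \<Longrightarrow> interior F = {} \<Longrightarrow> countable (Y \<inter> F)"
proof -
  define A where "A = {F :: 'a set. closed F \<and> interior F = {}}"
  have uncovered: "\<Union>\<G> \<noteq> UNIV" if "countable \<G>" "\<G> \<subseteq> A" for \<G>
  proof -
    have "euclidean interior_of \<Union>\<G> = {}"
      using that lc locally_compact_Hausdorff_imp_regular_space[OF lc Hausdorff]
      by (intro Baire_category_alt) (auto simp: A_def)
    then show ?thesis by auto
  qed
  have sing: "{x} \<in> A" for x
    using closedin_Hausdorff_singleton[OF Hausdorff, of x] perf[of x]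
      interior_subset[of "{x}"] open_interior[of "{x}"]
    by (force simp: A_def subset_singleton_iff simp del: open_interior)
  have "|A| \<le>o |{F :: 'a set. closed F}|"
    by (rule card_of_mono1) (auto simp: A_def)
  then have "|A| \<le>o |UNIV :: nat set set|"
    using card_of_closed_sets_ordLeq by (rule ordLeq_transitive)
  then obtain r where r: "refl_on A r" "total_on A r" "\<And>a. a \<in> A \<Longrightarrow> countable {b. (b, a) \<in> r}"
    using Continuum_Hypothesis_countable_initial_segments[OF CH] by blast
  \<comment> \<open>The choice for \<open>F\<close> depends only on the segment up to
    \<open>F\<close>, not on points picked before, so plain choice replaces transfinite recursion.
    Different \<open>F\<close> may share a point, which is why uncountability needs an argument
    below.\<close>
  have "\<exists>y. \<forall>G\<in>A. (G, F) \<in> r \<longrightarrow> y \<notin> G" if "F \<in> A" for F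
  proof -
    have "countable {G \<in> A. (G, F) \<in> r}"
      using r(3)[OF that] by (rule countable_subset[rotated]) auto
    then show ?thesis
      using uncovered[of "{G \<in> A. (G, F) \<in> r}"] by blast
  qed
  then obtain y where y: "\<And>F G. F \<in> A \<Longrightarrow> G \<in> A \<Longrightarrow> (G, F) \<in> r \<Longrightarrow> y F \<notin> G"
    by metis
  show thesis
  proof
    show "uncountable (y ` A)"
    proof
      assume "countable (y ` A)"
      \<comment> \<open>If only countably many points were picked, some \<open>F\<close> would lie
        beyond the singletons of all of them, including \<open>{y F}\<close>; but then
        \<open>y F\<close> would have to avoid \<open>{y F}\<close>.\<close>
      let ?C = "(\<lambda>x. {x}) ` y ` A"
      have "countable (\<Union>C\<in>?C. {F. (F, C) \<in> r})"
        using \<open>countable (y ` A)\<close> r(3) sing by (intro countable_UN) auto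
      moreover have "uncountable A"
        using uncovered[of A] sing by blast
      ultimately have "\<not> A \<subseteq> (\<Union>C\<in>?C. {F. (F, C) \<in> r})"
        using countable_subset by blast
      then obtain F where F: "F \<in> A" "\<And>C. C \<in> ?C \<Longrightarrow> (F, C) \<notin> r"
        by blast
      have "{y F} \<in> ?C" "{y F} \<in> A"
        using F(1) sing by auto
      then have "({y F}, F) \<in> r"
        using F r(1,2) by (metis refl_onD total_on_def)
      then show False
        using y[OF F(1) \<open>{y F} \<in> A\<close>] by simp
    qed
    fix F :: "'a set" assume "closed F" "interior F = {}"
    then have "F \<in> A" by (simp add: A_def)
    \<comment> \<open>Otherwise \<open>F\<close> comes before \<open>G\<close>, and
      \<open>y G\<close> was chosen outside \<open>F\<close>.\<close>
    have "(G, F) \<in> r" if "G \<in> A" "y G \<in> F" for G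
      using y[OF that(1) \<open>F \<in> A\<close>] that \<open>F \<in> A\<close> r(1,2) by (metis refl_onD total_on_def)
    then have "y ` A \<inter> F \<subseteq> y ` {G. (G, F) \<in> r}"
      by blast
    then show "countable (y ` A \<inter> F)"
      using r(3)[OF \<open>F \<in> A\<close>] by (meson countable_image countable_subset)
  qed
qed

text \<open>Through the class instance for countable products, this makes
  \<open>nat \<Rightarrow> bool\<close> second countable.\<close>

instance bool :: second_countable_topology
proof
  have "open = generate_topology (UNIV :: bool set set)"
    by (auto simp: fun_eq_iff open_discrete intro: generate_topology.Basis)
  then show "\<exists>B :: bool set set. countable B \<and> open = generate_topology B"
    by (metis countable_finite finite)
qed

lemma Cantor_space_not_open_singleton: "\<not> open {x :: nat \<Rightarrow> bool}"
proof
  assume "open {x}"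
  then have "openin (product_topology (\<lambda>_. euclidean) UNIV) {x}"
    by (simp add: open_fun_def)
  then obtain X where X: "x \<in> (\<Pi>\<^sub>E i\<in>UNIV. X i)" "finite {i. X i \<noteq> UNIV}" "(\<Pi>\<^sub>E i\<in>UNIV. X i) \<subseteq> {x}"
    using product_topology_open_contains_basis[of "\<lambda>_. euclidean" UNIV "{x}" x] by auto
  \<comment> \<open>A basic open box restricts only finitely many coordinates; flipping a free one
    gives a second point of the box.\<close>
  obtain n where "X n = UNIV"
    using X(2) ex_new_if_finite[OF infinite_UNIV_nat] by blast
  then have "x(n := \<not> x n) \<in> (\<Pi>\<^sub>E i\<in>UNIV. X i)"
    using X(1) by (auto simp: PiE_iff)
  then have "x(n := \<not> x n) = x"
    using X(3) by blast
  then show False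
    by (metis fun_upd_same)
qed

lemma Hausdorff_space_euclidean_t2: "Hausdorff_space (euclidean :: 'a::t2_space topology)"
  unfolding Hausdorff_space_def disjnt_def open_openin[symmetric] by (metis hausdorff)

lemma Cantor_space_compact_Hausdorff:
  "compact_space (euclidean :: (nat \<Rightarrow> bool) topology)"
  "Hausdorff_space (euclidean :: (nat \<Rightarrow> bool) topology)"
  unfolding euclidean_product_topology[symmetric] compact_space_product_topology
    Hausdorff_space_product_topology
  by (simp_all add: compact_space_def finite_imp_compact Hausdorff_space_euclidean_t2)

theorem proposition12:
  assumes "Continuum_Hypothesis"
  shows "\<not> Grinzing (UNIV :: (nat \<Rightarrow> bool) set)"
proof
  assume G: "Grinzing (UNIV :: (nat \<Rightarrow> bool) set)"
  obtain Y :: "(nat \<Rightarrow> bool) set" where Y: "uncountable Y"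
    "\<And>F. closed F \<Longrightarrow> interior F = {} \<Longrightarrow> countable (Y \<inter> F)"
    by (rule Luzin_set_exists[OF assms, where 'a = "nat \<Rightarrow> bool"])
      (simp_all add: Cantor_space_not_open_singleton Cantor_space_compact_Hausdorff
        compact_imp_locally_compact_space)
  from G Y(1) obtain Z :: "nat set \<Rightarrow> (nat \<Rightarrow> bool) set"
    where Z: "\<And>\<alpha>. \<alpha> \<in> omega1 \<Longrightarrow> Z \<alpha> \<subseteq> Y \<and> uncountable (Z \<alpha>)"
      and disj: "\<And>\<alpha> \<beta>. \<alpha> \<in> omega1 \<Longrightarrow> \<beta> \<in> omega1 \<Longrightarrow> \<alpha> \<noteq> \<beta> \<Longrightarrow> closure (Z \<alpha>) \<inter> closure (Z \<beta>) = {}"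
    unfolding Grinzing_def by (metis subset_UNIV)
  have int: "interior (closure (Z \<alpha>)) \<noteq> {}" if "\<alpha> \<in> omega1" for \<alpha>
  proof
    assume "interior (closure (Z \<alpha>)) = {}"
    then have "countable (Y \<inter> closure (Z \<alpha>))"
      by (intro Y(2)) auto
    moreover have "Z \<alpha> \<subseteq> Y \<inter> closure (Z \<alpha>)"
      using Z[OF that] closure_subset by blast
    ultimately show False
      using Z[OF that] countable_subset by blast
  qed
  have "countable ((\<lambda>\<alpha>. closure (Z \<alpha>)) ` omega1)"
  proof (rule countable_disjoint_nonempty_interior_subsets)
    show "disjoint ((\<lambda>\<alpha>. closure (Z \<alpha>)) ` omega1)"
      using disj by (fastforce simp: pairwise_def disjnt_def)
  qed (use int in auto)
  \<comment> \<open>The bound just obtained counts closures, not indices. Two indices with the same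
    closure would make it disjoint from itself, hence empty, against \<open>int\<close>.\<close>
  moreover have "inj_on (\<lambda>\<alpha>. closure (Z \<alpha>)) omega1"
  proof (rule inj_onI, rule ccontr)
    fix \<alpha> \<beta> assume *: "\<alpha> \<in> omega1" "\<beta> \<in> omega1" "closure (Z \<alpha>) = closure (Z \<beta>)" "\<alpha> \<noteq> \<beta>"
    then have "closure (Z \<alpha>) = {}"
      using disj[of \<alpha> \<beta>] by simp
    then show False
      using int[OF *(1)] by simp
  qed
  ultimately show False
    using uncountable_omega1 countable_image_inj_on by blast
qed

end
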